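(* Let $G$ be an AG-group. Then: (i) if $Par(a,b,c,d)$ holds then $Par(c,d,a,b)$ holds, for all $a,b,c,d\in G$; (ii) for any three points $a,b,c\in G$ there is one and only one point $d\in G$ such that $Par(a,b,c,d)$ holds.
   Context: An AG-group is a set $G$ with a binary operation (written as juxtaposition, in general neither associative nor commutative) satisfying the left invertive law $(xy)z=(zy)x$ for all $x,y,z\in G$, having a left identity $e$ (so $ex=x$ for all $x\in G$), and such that every $a\in G$ has an inverse $a^{-1}\in G$ with $a^{-1}a=aa^{-1}=e$. For $a,b,c,d\in G$, we say that $a,b,c,d$ form a parallelogram, written $Par(a,b,c,d)$, if there are $p,q\in G$ such that $pa=qb$ and $pd=qc$. *)

theory Defs
  imports "HOL-Algebra.Group"
begin

(* The monoid record serves only as a signature: neither associativity nor a right unit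
   is assumed, and the field one is the left identity e. *)
locale ag_group =
  fixes G :: "('a, 'b) monoid_scheme" (structure)
  assumes m_closed: "\<lbrakk>x \<in> carrier G; y \<in> carrier G\<rbrakk> \<Longrightarrow> x \<otimes> y \<in> carrier G"
    and left_invertive:
      "\<lbrakk>x \<in> carrier G; y \<in> carrier G; z \<in> carrier G\<rbrakk> \<Longrightarrow> (x \<otimes> y) \<otimes> z = (z \<otimes> y) \<otimes> x"
    and one_closed: "\<one> \<in> carrier G"
    and l_one: "x \<in> carrier G \<Longrightarrow> \<one> \<otimes> x = x"
    and inv_ex: "a \<in> carrier G \<Longrightarrow> \<exists>a' \<in> carrier G. a' \<otimes> a = \<one> \<and> a \<otimes> a' = \<one>"

definition Par :: "('a, 'b) monoid_scheme \<Rightarrow> 'a \<Rightarrow> 'a \<Rightarrow> 'a \<Rightarrow> 'a \<Rightarrow> bool" where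
  "Par G a b c d \<longleftrightarrow>
     (\<exists>p \<in> carrier G. \<exists>q \<in> carrier G. p \<otimes>\<^bsub>G\<^esub> a = q \<otimes>\<^bsub>G\<^esub> b \<and> p \<otimes>\<^bsub>G\<^esub> d = q \<otimes>\<^bsub>G\<^esub> c)"

end

theory Submission
  imports Defs
begin

text \<open>
  The operation \<open>(x \<otimes> \<one>) \<otimes> y\<close> is commutative, and \<open>Par G a b c d\<close> amounts to
  \<open>d + b = c + a\<close> when it is written additively; cancellation then gives uniqueness of \<open>d\<close>.
  Symmetry of \<open>Par\<close> is obtained by exchanging the two witnesses.
\<close>

context ag_group
begin

text \<open>The left invertive law reverses the three outer factors, then the three inside the
  product, then the outer ones again.\<close>

lemma medial:
  assumes "a \<in> carrier G" "b \<in> carrier G" "c \<in> carrier G" "d \<in> carrier G"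
  shows "(a \<otimes> b) \<otimes> (c \<otimes> d) = (a \<otimes> c) \<otimes> (b \<otimes> d)"
proof -
  have "(a \<otimes> b) \<otimes> (c \<otimes> d) = ((c \<otimes> d) \<otimes> b) \<otimes> a"
    using assms by (intro left_invertive m_closed)
  also have "\<dots> = ((b \<otimes> d) \<otimes> c) \<otimes> a"
    using assms left_invertive by simp
  also have "\<dots> = (a \<otimes> c) \<otimes> (b \<otimes> d)"
    using assms by (intro left_invertive m_closed)
  finally show ?thesis .
qed

text \<open>This is the medial law with the left identity as its first factor.\<close>

lemma left_commute:
  assumes "x \<in> carrier G" "y \<in> carrier G" "z \<in> carrier G"
  shows "x \<otimes> (y \<otimes> z) = y \<otimes> (x \<otimes> z)"
  using medial[OF one_closed assms] assms by (simp add: l_one)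

text \<open>Multiplying on the right by an inverse \<open>a'\<close> undoes right multiplication by
  \<open>a\<close>: left invertivity turns \<open>(z \<otimes> a) \<otimes> a'\<close> into
  \<open>(a' \<otimes> a) \<otimes> z\<close>.\<close>

lemma right_cancel:
  assumes x: "x \<in> carrier G" and y: "y \<in> carrier G" and a: "a \<in> carrier G"
    and eq: "x \<otimes> a = y \<otimes> a"
  shows "x = y"
proof -
  obtain a' where a': "a' \<in> carrier G" "a' \<otimes> a = \<one>"
    using inv_ex[OF a] by blast
  have "(z \<otimes> a) \<otimes> a' = z" if "z \<in> carrier G" for z
    using left_invertive[OF that a a'(1)] a' that by (simp add: l_one)
  then show ?thesis using x y eq by metis
qed

text \<open>Without associativity \<open>p' \<otimes> z\<close> need not solve the equation. The
  extra factor \<open>\<one>\<close> in \<open>p' \<otimes> \<one>\<close> is there for the medial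
  law, which exchanges it with \<open>p\<close> and so brings \<open>p'\<close> and \<open>p\<close>
  together.\<close>

lemma left_solve:
  assumes p: "p \<in> carrier G" and p': "p' \<in> carrier G" "p' \<otimes> p = \<one>" and z: "z \<in> carrier G"
  shows "p \<otimes> ((p' \<otimes> \<one>) \<otimes> z) = z"
proof -
  have "p \<otimes> ((p' \<otimes> \<one>) \<otimes> z) = (p' \<otimes> \<one>) \<otimes> (p \<otimes> z)"
    using p p' z by (intro left_commute m_closed one_closed)
  also have "\<dots> = (p' \<otimes> p) \<otimes> (\<one> \<otimes> z)"
    using p p' z by (intro medial one_closed)
  finally show ?thesis using p' z by (simp add: l_one)
qed

lemma left_cancel:
  assumes p: "p \<in> carrier G" and x: "x \<in> carrier G" and y: "y \<in> carrier G"
    and eq: "p \<otimes> x = p \<otimes> y"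
  shows "x = y"
proof -
  obtain p' where p': "p' \<in> carrier G" "p' \<otimes> p = \<one>"
    using inv_ex[OF p] by blast
  \<comment> \<open>By \<open>left_commute\<close>, the right inverse of left multiplication by
    \<open>p\<close> given by \<open>left_solve\<close> is also a left inverse.\<close>
  have "(p' \<otimes> \<one>) \<otimes> (p \<otimes> z) = z" if "z \<in> carrier G" for z
    using left_solve[OF p p' that] left_commute[of "p' \<otimes> \<one>" p z] p p' that
    by (simp add: m_closed one_closed)
  then show ?thesis using x y eq by metis
qed

lemma Par_sym:
  assumes "Par G a b c d"
  shows "Par G c d a b"
  using assms unfolding Par_def by (blast intro: sym)

text \<open>The two sides are compared after multiplication by \<open>p\<close>.
  \<open>left_commute\<close> moves \<open>p\<close> and \<open>q\<close> next to the points where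
  the equations of \<open>Par\<close> apply, and \<open>left_cancel\<close> removes \<open>p\<close>
  at the end.\<close>

lemma Par_imp_add_eq:
  assumes abcd: "a \<in> carrier G" "b \<in> carrier G" "c \<in> carrier G" "d \<in> carrier G"
    and par: "Par G a b c d"
  shows "(d \<otimes> \<one>) \<otimes> b = (c \<otimes> \<one>) \<otimes> a"
proof -
  obtain p q where pq: "p \<in> carrier G" "q \<in> carrier G"
    and eqs: "p \<otimes> a = q \<otimes> b" "p \<otimes> d = q \<otimes> c"
    using par unfolding Par_def by blast
  note mem = abcd pq m_closed one_closed
  have "p \<otimes> ((c \<otimes> \<one>) \<otimes> a) = (c \<otimes> \<one>) \<otimes> (q \<otimes> b)"
    using left_commute[of p "c \<otimes> \<one>" a] mem eqs by simp
  also have "\<dots> = q \<otimes> ((c \<otimes> \<one>) \<otimes> b)"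
    using mem by (intro left_commute)
  \<comment> \<open>Commutativity of \<open>(x \<otimes> \<one>) \<otimes> y\<close> is left
    invertivity with middle factor \<open>\<one>\<close>.\<close>
  also have "\<dots> = q \<otimes> ((b \<otimes> \<one>) \<otimes> c)"
    using left_invertive[of c \<one> b] mem by simp
  also have "\<dots> = (b \<otimes> \<one>) \<otimes> (p \<otimes> d)"
    using left_commute[of q "b \<otimes> \<one>" c] mem eqs by simp
  also have "\<dots> = p \<otimes> ((b \<otimes> \<one>) \<otimes> d)"
    using mem by (intro left_commute)
  also have "\<dots> = p \<otimes> ((d \<otimes> \<one>) \<otimes> b)"
    using left_invertive[of b \<one> d] mem by simp
  finally show ?thesis
    using left_cancel[of p "(d \<otimes> \<one>) \<otimes> b" "(c \<otimes> \<one>) \<otimes> a"] mem by simp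
qed

lemma Par_unique:
  assumes abc: "a \<in> carrier G" "b \<in> carrier G" "c \<in> carrier G"
    and d: "d \<in> carrier G" "Par G a b c d" and d': "d' \<in> carrier G" "Par G a b c d'"
  shows "d = d'"
proof -
  have "(d \<otimes> \<one>) \<otimes> b = (d' \<otimes> \<one>) \<otimes> b"
    using Par_imp_add_eq[OF abc d] Par_imp_add_eq[OF abc d'] by simp
  then have "d \<otimes> \<one> = d' \<otimes> \<one>"
    using right_cancel[of "d \<otimes> \<one>" "d' \<otimes> \<one>" b] abc d d' m_closed one_closed by blast
  then show ?thesis
    using right_cancel[of d d' \<one>] d d' one_closed by blast
qed

lemma Par_ex:
  assumes a: "a \<in> carrier G" and b: "b \<in> carrier G" and c: "c \<in> carrier G"
  shows "\<exists>d \<in> carrier G. Par G a b c d"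
proof -
  obtain a' where a': "a' \<in> carrier G" "a \<otimes> a' = \<one>"
    using inv_ex[OF a] by blast
  \<comment> \<open>The witness \<open>q\<close> is taken to be \<open>\<one>\<close>, so
    \<open>?p\<close> has to send \<open>a\<close> to \<open>b\<close>; then \<open>?d\<close> is
    the solution of \<open>?p \<otimes> d = c\<close> from \<open>left_solve\<close>.\<close>
  let ?p = "b \<otimes> a'"
  have p: "?p \<in> carrier G" using a' b by (intro m_closed)
  obtain p' where p': "p' \<in> carrier G" "p' \<otimes> ?p = \<one>"
    using inv_ex[OF p] by blast
  let ?d = "(p' \<otimes> \<one>) \<otimes> c"
  have "?p \<otimes> a = \<one> \<otimes> b"
    using left_invertive[OF b a'(1) a] a' by simp
  moreover have "?p \<otimes> ?d = \<one> \<otimes> c"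
    using left_solve[OF p p' c] c by (simp add: l_one)
  ultimately have "Par G a b c ?d"
    unfolding Par_def using p one_closed by blast
  moreover have "?d \<in> carrier G"
    using p' c by (intro m_closed one_closed)
  ultimately show ?thesis by blast
qed

end

theorem lemma2:
  fixes G :: "('a, 'b) monoid_scheme"
  assumes "ag_group G"
  shows "(\<forall>a \<in> carrier G. \<forall>b \<in> carrier G. \<forall>c \<in> carrier G. \<forall>d \<in> carrier G.
            Par G a b c d \<longrightarrow> Par G c d a b) \<and>
         (\<forall>a \<in> carrier G. \<forall>b \<in> carrier G. \<forall>c \<in> carrier G.
            \<exists>!d. d \<in> carrier G \<and> Par G a b c d)"
proof -
  interpret ag_group G by fact
  show ?thesis
  proof (intro conjI ballI impI ex_ex1I)
    fix a b c d assume "Par G a b c d"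
    then show "Par G c d a b" by (rule Par_sym)
  next
    fix a b c assume "a \<in> carrier G" "b \<in> carrier G" "c \<in> carrier G"
    then show "\<exists>d. d \<in> carrier G \<and> Par G a b c d"
      using Par_ex by blast
  next
    fix a b c d d'
    assume "a \<in> carrier G" "b \<in> carrier G" "c \<in> carrier G"
      and "d \<in> carrier G \<and> Par G a b c d" "d' \<in> carrier G \<and> Par G a b c d'"
    then show "d = d'"
      using Par_unique by blast
  qed
qed

end
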